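(* Let $k$ be $\mathbb Q$ or a prime field $\mathbb F_p$, and let $V$ be a $k$-vector space of arbitrary dimension. There is a translation-invariant metric $d:V\times V\to[0,2]$ such that $$\mathrm{Isom}(V,d)=\mathrm{Aff}_{\pm}(V),$$ with the following further properties. For $k=\mathbb Q$ the metric takes at most countably many values. For $k=\mathbb F_p$ with $p$ odd, it takes at most $p+5$ values. For $k=\mathbb F_2$, it takes at most six values, and $\mathrm{Aff}_{\pm}(V)=T(V)$. All these metrics are bounded, uniformly discrete, and complete. The bounds on the number of values include zero and are independent of the dimension.
   Context: A metric $d$ on $V$ is translation-invariant if $d(x+c,y+c)=d(x,y)$ for all $x,y,c\in V$. An isometry is a surjective distance-preserving map; $\mathrm{Isom}(V,d)$ is the group of isometries of $(V,d)$ onto itself (no linearity or additivity is assumed). Put $$T(V)=\{x\mapsto c+x: c\in V\},\qquad \mathrm{Aff}_{\pm}(V)=\{x\mapsto c+\sigma x: c\in V,\ \sigma\in\{1,-1\}\}.$$ A metric is uniformly discrete if its nonzero distances have a positive lower bound. Work in ZFC. *)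

theory Defs
  imports "HOL-Analysis.Abstract_Metric_Spaces" "Berlekamp_Zassenhaus.Finite_Field"
begin

text \<open>
  The vector space V is the whole type, with scalar multiplication given by an arbitrary
  function satisfying the locale \<^locale>\<open>vector_space\<close>; a metric on V is a function \<open>d\<close> with
  \<open>Metric_space UNIV d\<close>.  The field with p elements is \<open>'p mod_ring\<close>, where p is \<open>CARD('p)\<close>.
\<close>

definition translation_invariant :: "('v::ab_group_add \<Rightarrow> 'v \<Rightarrow> real) \<Rightarrow> bool" where
  "translation_invariant d \<longleftrightarrow> (\<forall>x y c. d (x + c) (y + c) = d x y)"

definition Isom :: "('v \<Rightarrow> 'v \<Rightarrow> real) \<Rightarrow> ('v \<Rightarrow> 'v) set" where
  "Isom d = {f. surj f \<and> (\<forall>x y. d (f x) (f y) = d x y)}"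

definition Transl :: "('v::ab_group_add \<Rightarrow> 'v) set" where
  "Transl = {(\<lambda>x. c + x) | c. True}"

definition Aff_pm :: "('k::field \<Rightarrow> 'v::ab_group_add \<Rightarrow> 'v) \<Rightarrow> ('v \<Rightarrow> 'v) set" where
  "Aff_pm smul = {(\<lambda>x. c + smul \<sigma> x) | c \<sigma>. \<sigma> \<in> {1, - 1}}"

definition metric_values :: "('v \<Rightarrow> 'v \<Rightarrow> real) \<Rightarrow> real set" where
  "metric_values d = {d x y | x y. True}"

definition uniformly_discrete :: "('v \<Rightarrow> 'v \<Rightarrow> real) \<Rightarrow> bool" where
  "uniformly_discrete d \<longleftrightarrow> (\<exists>\<epsilon>>0. \<forall>r\<in>metric_values d. r \<noteq> 0 \<longrightarrow> \<epsilon> \<le> r)"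

end

(*
  For a symmetric "colour" function on V with values in [1,2] off zero, d(x,y) = colour (x - y) is
  automatically a translation-invariant metric, so the task is to make the coloured Cayley graph of V
  rigid up to translations and sign.  Fix a basis B, well-ordered.  The elements a b (b in B) are
  coloured by a up to sign; the sums b + c of distinct basis vectors receive two further colours
  according to whether {b,c} is an edge of a graph on B; the vectors b and -b with b "even" in the
  well-order receive their own colour.  An isometry fixing 0 sends lines x + k b to lines, and since
  two such lines in different directions span a parallelogram in a unique way, it is linear and
  permutes the basis up to signs.  Colouring the sums b + c, and not the differences, forces all
  signs to be equal.  The graph joins an even b to an odd c whenever b < c; even and odd elements
  alternate, so it has no automorphism preserving parity, and the permutation is trivial.
*)
theory Submission
  imports Defs
begin

section \<open>Rigid vertex-coloured graphs from well-orders\<close>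

text \<open>Loops are ignored because only sums of two distinct basis vectors will carry an edge
  colour.\<close>

definition rigid_graph :: "'a set \<Rightarrow> ('a \<Rightarrow> bool) \<Rightarrow> ('a \<Rightarrow> 'a \<Rightarrow> bool) \<Rightarrow> bool" where
  "rigid_graph B P E \<longleftrightarrow> (\<forall>x y. E x y \<longleftrightarrow> E y x) \<and>
     (\<forall>\<pi>. bij_betw \<pi> B B \<and> (\<forall>x\<in>B. P (\<pi> x) = P x) \<and>
          (\<forall>x\<in>B. \<forall>y\<in>B. x \<noteq> y \<longrightarrow> E (\<pi> x) (\<pi> y) = E x y) \<longrightarrow> (\<forall>x\<in>B. \<pi> x = x))"

text \<open>An automorphism respecting parity preserves the order between even and odd elements.
  Since parities alternate, the least moved element would be separated from its image and from its
  preimage by elements of opposite parity, which is impossible.\<close>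

lemma rigid_graph_exists: "\<exists>P E. rigid_graph B P E"
proof -
  obtain r where r: "well_order_on B r" using well_order_on by blast
  define lt where "lt x y \<longleftrightarrow> (x, y) \<in> r - Id" for x y
  have "{(x, y). lt x y} = r - Id" by (auto simp: lt_def)
  then have wf: "wf {(x, y). lt x y}"
    using r by (simp add: well_order_on_def)
  have lin: "linear_order_on B r" using r by (simp add: well_order_on_def)
  have trans: "lt x z" if "lt x y" "lt y z" for x y z
    using that lin unfolding lt_def order_on_defs trans_def antisym_def by blast
  have irrefl: "\<not> lt x x" for x by (simp add: lt_def)
  have total: "lt x y \<or> x = y \<or> lt y x" if "x \<in> B" "y \<in> B" for x y
    using that lin unfolding lt_def order_on_defs total_on_def by blast
  have in_B: "x \<in> B \<and> y \<in> B" if "lt x y" for x y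
    using that lin unfolding lt_def order_on_defs refl_on_def by blast
  define is_succ where "is_succ x y \<longleftrightarrow> lt x y \<and> (\<forall>z. lt x z \<longrightarrow> z = y \<or> lt y z)" for x y
  \<comment> \<open>parity: limit elements and the least element are odd (\<open>P\<close> fails), successors alternate\<close>
  define P where "P = wfrec {(x, y). lt x y} (\<lambda>P y. \<exists>x. is_succ x y \<and> \<not> P x)"
  have P_rec: "P y \<longleftrightarrow> (\<exists>x. is_succ x y \<and> \<not> P x)" for y
  proof -
    have "P y \<longleftrightarrow> (\<exists>x. is_succ x y \<and> \<not> cut P {(x, y). lt x y} y x)"
      unfolding P_def by (subst wfrec[OF wf]) simp
    also have "\<dots> \<longleftrightarrow> (\<exists>x. is_succ x y \<and> \<not> P x)"
      by (auto simp: cut_def is_succ_def)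
    finally show ?thesis .
  qed
  \<comment> \<open>Predecessors are unique, so the existential in \<open>P_rec\<close> speaks of
    \<open>x\<close> alone.\<close>
  have P_succ: "P y \<longleftrightarrow> \<not> P x" if "is_succ x y" for x y
  proof -
    have not_lt: "\<not> lt u v" if "is_succ u y" "is_succ v y" for u v
    proof
      assume "lt u v"
      then have "v = y \<or> lt y v" "lt v y" using that by (auto simp: is_succ_def)
      then show False using trans irrefl by blast
    qed
    have "x' = x" if "is_succ x' y" for x'
      using not_lt[OF that \<open>is_succ x y\<close>] not_lt[OF \<open>is_succ x y\<close> that] total[of x x'] in_B[of x y] in_B[of x' y]
        that \<open>is_succ x y\<close> unfolding is_succ_def by blast
    with P_rec[of y] that show ?thesis by blast
  qed
  \<comment> \<open>The witness is the immediate successor of \<open>x\<close>. Its parity differs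
    from that of \<open>x\<close>, hence from that of \<open>y\<close>, so it comes strictly before
    \<open>y\<close>.\<close>
  have alternate: "\<exists>s. lt x s \<and> lt s y \<and> P s = (\<not> P x)" if "lt x y" "P x = P y" for x y
  proof -
    have "\<exists>s\<in>{z. lt x z}. \<forall>z. (z, s) \<in> {(x, y). lt x y} \<longrightarrow> z \<notin> {z. lt x z}"
      using wf that(1) unfolding wf_eq_minimal by blast
    then obtain s where s: "lt x s" "\<And>z. lt z s \<Longrightarrow> \<not> lt x z" by blast
    have "is_succ x s"
      unfolding is_succ_def using s total in_B by blast
    moreover from this have "s \<noteq> y" using P_succ that(2) by blast
    ultimately show ?thesis
      using P_succ that(1) unfolding is_succ_def by blast
  qed
  define R where "R x y \<longleftrightarrow> P x \<and> \<not> P y \<and> lt x y" for x y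
  define E where "E x y \<longleftrightarrow> R x y \<or> R y x" for x y
  have "rigid_graph B P E"
    unfolding rigid_graph_def
  proof (intro conjI allI impI ballI; (elim conjE)?)
    show "E x y \<longleftrightarrow> E y x" for x y by (auto simp: E_def)
  next
    fix \<pi> x
    assume bij: "bij_betw \<pi> B B" and "\<forall>x\<in>B. P (\<pi> x) = P x"
      and "\<forall>x\<in>B. \<forall>y\<in>B. x \<noteq> y \<longrightarrow> E (\<pi> x) (\<pi> y) = E x y" and "x \<in> B"
    then have P_pres: "P (\<pi> y) = P y" if "y \<in> B" for y
      using that by blast
    have E_pres: "E (\<pi> y) (\<pi> z) = E y z" if "y \<in> B" "z \<in> B" "y \<noteq> z" for y z
      using that \<open>\<forall>x\<in>B. \<forall>y\<in>B. x \<noteq> y \<longrightarrow> E (\<pi> x) (\<pi> y) = E x y\<close> by blast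
    \<comment> \<open>For even \<open>y\<close> and odd \<open>z\<close>, being adjacent means
      exactly \<open>lt y z\<close>; the reverse orientation of \<open>R\<close> is ruled out by
      parity.\<close>
    have lt_pres: "lt (\<pi> y) (\<pi> z) = lt y z" if "y \<in> B" "z \<in> B" "P y" "\<not> P z" for y z
    proof -
      have "E (\<pi> y) (\<pi> z) = E y z" using E_pres that by blast
      then show ?thesis using that P_pres by (simp add: E_def R_def)
    qed
    have inj: "y = z" if "\<pi> y = \<pi> z" "y \<in> B" "z \<in> B" for y z
      using bij that by (auto simp: bij_betw_def inj_on_def)
    have maps: "\<pi> y \<in> B" if "y \<in> B" for y using bij that by (auto simp: bij_betw_def)
    have onto: "\<exists>z\<in>B. \<pi> z = y" if "y \<in> B" for y
      using bij that by (force simp: bij_betw_def)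
    from wf \<open>x \<in> B\<close> show "\<pi> x = x"
    proof (induction x rule: wf_induct_rule)
      case (less x)
      have IH: "\<pi> y = y" if "lt y x" for y using less.IH that in_B by auto
      show ?case
      proof (rule ccontr)
        assume neq: "\<pi> x \<noteq> x"
        have "\<not> lt (\<pi> x) x" using IH inj less.prems maps neq by blast
        then have above: "lt x (\<pi> x)" using total less.prems maps neq by metis
        obtain z where z: "z \<in> B" "\<pi> z = x" using onto less.prems by blast
        have "\<not> lt z x" using IH z irrefl by metis
        then have z_above: "lt x z" using total less.prems z neq by metis
        show False
        proof (cases "P x")
          case True
          \<comment> \<open>The preimage \<open>t\<close> of this odd \<open>s\<close> cannot lie
            above the even \<open>x\<close>, since then \<open>s\<close> would lie above
            \<open>\<pi> x\<close>. So \<open>t\<close> lies below \<open>x\<close>, is fixed, and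
            equals \<open>s\<close>, which lies above \<open>x\<close>.\<close>
          then obtain s where s: "lt x s" "lt s (\<pi> x)" "\<not> P s"
            using alternate[OF above] P_pres less.prems by blast
          obtain t where t: "t \<in> B" "\<pi> t = s" using onto in_B s(1) by blast
          have "\<not> lt x t"
            using lt_pres[of x t] t s True P_pres less.prems trans irrefl by metis
          then have "lt t x" using total less.prems t s(3) True P_pres by metis
          then show False using IH t s(1) trans irrefl by metis
        next
          case False
          \<comment> \<open>The even \<open>s\<close> precedes the odd \<open>z\<close>, so
            \<open>\<pi> s\<close> precedes \<open>\<pi> z = x\<close> and is fixed. Injectivity
            then gives \<open>\<pi> s = s\<close>, although \<open>s\<close> is above
            \<open>x\<close>.\<close>
          then obtain s where s: "lt x s" "lt s z" "P s"
            using alternate[OF z_above] P_pres z by metis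
          have "lt (\<pi> s) x"
            using lt_pres[of s z] z s False P_pres in_B by metis
          then have "\<pi> s = s" using IH inj maps in_B s(1) by metis
          then show False using \<open>lt (\<pi> s) x\<close> s(1) trans irrefl by metis
        qed
      qed
    qed
  qed
  then show ?thesis by blast
qed

section \<open>The colouring of V and its values\<close>

text \<open>The range of \<open>\<nu>\<close> lies in (1, 3/2], away from the reserved colours 1,
  8/5, 9/5 and 2, so a value of \<open>\<nu>\<close> reveals a multiple of a basis vector together
  with its scalar up to sign.\<close>

locale rigid_colouring = vector_space scale
  for scale :: "'k::field \<Rightarrow> 'v::ab_group_add \<Rightarrow> 'v" (infixr \<open>\<odot>\<close> 75) +
  fixes B :: "'v set" and P :: "'v \<Rightarrow> bool" and E :: "'v \<Rightarrow> 'v \<Rightarrow> bool" and \<nu> :: "'k \<Rightarrow> real"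
  assumes independent: "\<not> dependent B" and span: "span B = UNIV"
    and rigid_graph: "rigid_graph B P E"
    and \<nu>_eq_iff: "\<nu> a = \<nu> b \<longleftrightarrow> a = b \<or> a = - b"
    and \<nu>_gt: "1 < \<nu> a" and \<nu>_le: "\<nu> a \<le> 3 / 2"
begin

abbreviation coord :: "'v \<Rightarrow> 'v \<Rightarrow> 'k" where "coord \<equiv> representation B"

lemma coord_add [simp]: "coord (x + y) b = coord x b + coord y b"
  using representation_add[OF independent] span by simp

lemma coord_scale [simp]: "coord (a \<odot> x) b = a * coord x b"
  using representation_scale[OF independent] span by simp

lemma coord_minus [simp]: "coord (- x) b = - coord x b"
  using representation_neg[OF independent] span by simp

lemma coord_basis [simp]: "b \<in> B \<Longrightarrow> coord b c = (if c = b then 1 else 0)"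
  using representation_basis[OF independent] by simp

lemma coord_zero [simp]: "coord 0 b = 0"
  by (simp add: representation_zero)

definition signed_basis :: "'v set" where "signed_basis = B \<union> uminus ` B"

lemma signed_basisE:
  assumes "e \<in> signed_basis"
  obtains b s where "b \<in> B" "s = 1 \<or> s = -1" "e = s \<odot> b"
  using assms unfolding signed_basis_def by (metis Un_iff image_iff scale_minus_left scale_one)

lemma signed_basis_scale:
  assumes "e \<in> signed_basis" "s = 1 \<or> s = -1" shows "s \<odot> e \<in> signed_basis"
  using assms unfolding signed_basis_def by auto

lemma basis_ne_0: "b \<in> B \<Longrightarrow> b \<noteq> 0"
  using independent dependent_zero by blast

text \<open>For \<open>x \<noteq> 0\<close> the basis vector and the scalar chosen below are determined by \<open>x\<close>, so the choice
  is harmless.\<close>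
definition colour :: "'v \<Rightarrow> real" where
  "colour x =
    (if x = 0 then 0
     else if \<exists>b\<in>B. P b \<and> (x = b \<or> x = - b) then 2
     else if \<exists>a. \<exists>b\<in>B. x = a \<odot> b then \<nu> (SOME a. \<exists>b\<in>B. x = a \<odot> b)
     else if \<exists>b\<in>B. \<exists>c\<in>B. b \<noteq> c \<and> E b c \<and> (x = b + c \<or> x = - (b + c)) then 9 / 5
     else if \<exists>b\<in>B. \<exists>c\<in>B. b \<noteq> c \<and> (x = b + c \<or> x = - (b + c)) then 8 / 5
     else 1)"

lemma colour_cases:
  \<comment> \<open>A coarse summary that hides the choice operator and the edge relation; it
    suffices for bounding colours and for reading the shape of a vector off its colour.\<close>
  "x = 0 \<and> colour x = 0 \<or>
   x \<noteq> 0 \<and> (\<exists>b\<in>B. P b \<and> (x = b \<or> x = - b)) \<and> colour x = 2 \<or>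
   (\<exists>a. a \<noteq> 0 \<and> (\<exists>b\<in>B. x = a \<odot> b) \<and> colour x = \<nu> a) \<or>
   x \<noteq> 0 \<and> (\<exists>b\<in>B. \<exists>c\<in>B. b \<noteq> c \<and> (x = b + c \<or> x = - (b + c))) \<and> (colour x = 9 / 5 \<or> colour x = 8 / 5) \<or>
   x \<noteq> 0 \<and> colour x = 1"
proof -
  consider "x = 0" | "x \<noteq> 0" "\<exists>b\<in>B. P b \<and> (x = b \<or> x = - b)"
    | "x \<noteq> 0" "\<not> (\<exists>b\<in>B. P b \<and> (x = b \<or> x = - b))" "\<exists>a. \<exists>b\<in>B. x = a \<odot> b"
    | "x \<noteq> 0" "\<not> (\<exists>b\<in>B. P b \<and> (x = b \<or> x = - b))" "\<not> (\<exists>a. \<exists>b\<in>B. x = a \<odot> b)" by blast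
  then show ?thesis
  proof cases
    case 3
    define a where "a = (SOME a. \<exists>b\<in>B. x = a \<odot> b)"
    have "\<exists>b\<in>B. x = a \<odot> b" unfolding a_def using 3(3) by (rule someI_ex)
    moreover have "colour x = \<nu> a"
      unfolding colour_def a_def if_not_P[OF 3(1)] if_not_P[OF 3(2)] if_P[OF 3(3)] ..
    moreover have "a \<noteq> 0" using 3(1) \<open>\<exists>b\<in>B. x = a \<odot> b\<close> by auto
    ultimately have "\<exists>a. a \<noteq> 0 \<and> (\<exists>b\<in>B. x = a \<odot> b) \<and> colour x = \<nu> a" using \<open>\<exists>b\<in>B. x = a \<odot> b\<close> by metis
    then show ?thesis by (rule disjI2[OF disjI2[OF disjI1]])
  next
    case 4
    then show ?thesis unfolding colour_def by auto
  qed (auto simp: colour_def)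
qed

lemma colour_ge_1: "x \<noteq> 0 \<Longrightarrow> 1 \<le> colour x"
  using colour_cases[of x] by (auto simp: less_imp_le[OF \<nu>_gt])

lemma colour_le_2: "colour x \<le> 2"
proof -
  have "\<nu> a \<le> 2" for a using \<nu>_le[of a] by simp
  then show ?thesis using colour_cases[of x] by auto
qed

lemma colour_0 [simp]: "colour 0 = 0"
  by (simp add: colour_def)

lemma colour_eq_0_iff: "colour x = 0 \<longleftrightarrow> x = 0"
  using colour_ge_1[of x] by fastforce

text \<open>Leaving out the scalar 0 saves one value, which the bound six over the field with two
  elements requires.\<close>

lemma range_colour: "range colour \<subseteq> {0, 1, 2, 8/5, 9/5} \<union> \<nu> ` (UNIV - {0})"
proof
  fix r assume "r \<in> range colour"
  then obtain x where "r = colour x" by blast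
  then show "r \<in> {0, 1, 2, 8/5, 9/5} \<union> \<nu> ` (UNIV - {0})"
    using colour_cases[of x] by blast
qed

lemma E_sym: "E x y \<longleftrightarrow> E y x"
  using rigid_graph unfolding rigid_graph_def by blast

lemma coord_eqI: "x = y \<Longrightarrow> coord x b = coord y b"
  by simp

lemma single_eqD:
  assumes "a \<odot> b = a' \<odot> b'" "b \<in> B" "b' \<in> B" "a \<noteq> 0"
  shows "a = a' \<and> b = b'"
proof -
  have "a * coord b b = a' * coord b' b" using coord_eqI[OF assms(1), of b] by simp
  then show ?thesis using assms(2-4) by (auto split: if_splits)
qed

text \<open>The right side has nonzero coordinates at two basis vectors, the left side at no more
  than one.\<close>

lemma single_ne_pair:
  assumes "b \<in> B" "c \<in> B" "c' \<in> B" "c \<noteq> c'" "s \<noteq> 0"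
  shows "a \<odot> b \<noteq> s \<odot> (c + c')"
proof
  assume eq: "a \<odot> b = s \<odot> (c + c')"
  show False
    using coord_eqI[OF eq, of c] coord_eqI[OF eq, of c'] assms by (auto split: if_splits)
qed

lemma colour_single:
  assumes "a \<noteq> 0" "b \<in> B"
  shows "colour (a \<odot> b) = (if (a = 1 \<or> a = -1) \<and> P b then 2 else \<nu> a)"
proof -
  have ne: "a \<odot> b \<noteq> 0" using assms basis_ne_0 by simp
  have "(\<exists>b'\<in>B. P b' \<and> (a \<odot> b = b' \<or> a \<odot> b = - b')) \<longleftrightarrow> (a = 1 \<or> a = -1) \<and> P b"
  proof
    assume "\<exists>b'\<in>B. P b' \<and> (a \<odot> b = b' \<or> a \<odot> b = - b')"
    then obtain b' where b': "b' \<in> B" "P b'" "a \<odot> b = 1 \<odot> b' \<or> a \<odot> b = (-1) \<odot> b'" by auto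
    then show "(a = 1 \<or> a = -1) \<and> P b" using single_eqD assms by metis
  qed (use assms in auto)
  moreover have "(SOME a'. \<exists>b'\<in>B. a \<odot> b = a' \<odot> b') = a"
    by (rule some_equality) (use assms single_eqD in metis)+
  moreover have "\<exists>a'. \<exists>b'\<in>B. a \<odot> b = a' \<odot> b'" using assms by blast
  ultimately show ?thesis using ne unfolding colour_def by presburger
qed

lemma pair_eqD:
  assumes "b \<in> B" "c \<in> B" "b \<noteq> c" "b' \<in> B" "c' \<in> B" "b' \<noteq> c'"
    and eq: "b + c = s \<odot> (b' + c')"
  shows "b = b' \<and> c = c' \<or> b = c' \<and> c = b'"
  using coord_eqI[OF eq, of b] coord_eqI[OF eq, of c] assms(1-6)
  by (auto split: if_splits)

lemma colour_pair:
  assumes b: "b \<in> B" and c: "c \<in> B" and bc: "b \<noteq> c"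
  shows "colour (b + c) = (if E b c then 9 / 5 else 8 / 5)"
proof -
  have not_single: "\<not> (\<exists>a. \<exists>b'\<in>B. b + c = a \<odot> b')"
    using single_ne_pair[of _ b c 1] assms by (metis scale_one one_neq_zero)
  moreover have "\<not> (\<exists>b'\<in>B. P b' \<and> (b + c = b' \<or> b + c = - b'))"
    using not_single by (metis scale_one scale_minus_left)
  moreover have "b + c \<noteq> 0" using not_single b by (metis scale_zero_left)
  moreover have "(\<exists>b'\<in>B. \<exists>c'\<in>B. b' \<noteq> c' \<and> E b' c' \<and> (b + c = b' + c' \<or> b + c = - (b' + c'))) \<longleftrightarrow> E b c"
  proof
    assume "\<exists>b'\<in>B. \<exists>c'\<in>B. b' \<noteq> c' \<and> E b' c' \<and> (b + c = b' + c' \<or> b + c = - (b' + c'))"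
    then obtain b' c' where *: "b' \<in> B" "c' \<in> B" "b' \<noteq> c'" "E b' c'"
      "b + c = 1 \<odot> (b' + c') \<or> b + c = (-1) \<odot> (b' + c')" by auto
    then show "E b c" using pair_eqD[OF assms *(1-3)] E_sym by metis
  qed (use assms in blast)
  moreover have "\<exists>b'\<in>B. \<exists>c'\<in>B. b' \<noteq> c' \<and> (b + c = b' + c' \<or> b + c = - (b' + c'))"
    using assms by blast
  ultimately show ?thesis unfolding colour_def by presburger
qed

text \<open>Every clause of \<open>colour\<close> is visibly symmetric except the one with the
  chosen scalar, where the evenness of \<open>\<nu>\<close> helps.\<close>

lemma colour_minus: "colour (- x) = colour x"
proof -
  have special: "(\<exists>b\<in>B. P b \<and> (- x = b \<or> - x = - b)) \<longleftrightarrow> (\<exists>b\<in>B. P b \<and> (x = b \<or> x = - b))"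
    by (metis minus_minus)
  have pair: "- x = b + c \<or> - x = - (b + c) \<longleftrightarrow> x = b + c \<or> x = - (b + c)" for b c
    by (metis minus_minus)
  have single: "(\<exists>a. \<exists>b\<in>B. - x = a \<odot> b) \<longleftrightarrow> (\<exists>a. \<exists>b\<in>B. x = a \<odot> b)"
    by (metis minus_minus scale_minus_left)
  show ?thesis
  proof (cases "x \<noteq> 0 \<and> (\<exists>a. \<exists>b\<in>B. x = a \<odot> b)")
    case True
    then obtain a b where ab: "a \<noteq> 0" "b \<in> B" "x = a \<odot> b" by auto
    have "- a \<noteq> 0" "- a = 1 \<or> - a = -1 \<longleftrightarrow> a = 1 \<or> a = -1"
      using ab(1) by (auto simp: minus_equation_iff)
    then have "colour ((- a) \<odot> b) = colour (a \<odot> b)"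
      using colour_single[of "- a" b] colour_single[of a b] ab(1,2) \<nu>_eq_iff[of "- a" a] by argo
    then show ?thesis using ab by simp
  next
    case False
    then have "x = 0 \<or> \<not> (\<exists>a. \<exists>b\<in>B. x = a \<odot> b)" "x = 0 \<or> \<not> (\<exists>a. \<exists>b\<in>B. - x = a \<odot> b)"
      using single by blast+
    then show ?thesis
      unfolding colour_def pair using special by (smt (verit) neg_equal_0_iff_equal)
  qed
qed

section \<open>Recovering vectors from colours, and coordinate rigidity\<close>

text \<open>Such a colour is 2 or a value of \<open>\<nu>\<close>, so it occurs only on multiples of
  basis vectors. The sign of the scalar stays undetermined and is absorbed into
  \<open>e\<close>.\<close>

lemma colour_eq_single:
  assumes "colour y = colour (a \<odot> b)" "a \<noteq> 0" "b \<in> B"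
  obtains e where "e \<in> signed_basis" "y = a \<odot> e"
proof -
  have col: "colour y = 2 \<and> (a = 1 \<or> a = -1) \<or> colour y = \<nu> a"
    using assms colour_single by presburger
  then have "1 < colour y" "colour y \<noteq> 9/5" "colour y \<noteq> 8/5"
    using \<nu>_gt[of a] \<nu>_le[of a] by auto
  then consider "colour y = 2" "\<exists>b\<in>B. y = b \<or> y = - b"
    | a' where "\<exists>b\<in>B. y = a' \<odot> b" "colour y = \<nu> a'"
    using colour_cases[of y] by auto
  then show thesis
  proof cases
    case 1
    then have "y \<in> signed_basis" by (auto simp: signed_basis_def)
    moreover have "a = 1 \<or> a = -1" using 1 col \<nu>_le[of a] by auto
    \<comment> \<open>The witness \<open>a \<odot> y\<close> works because the square of
      \<open>a\<close> is 1.\<close>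
    ultimately show thesis
      using that[of "a \<odot> y"] signed_basis_scale by auto
  next
    case 2
    then have "a' = a \<or> a' = - a" using col \<nu>_le[of a'] \<nu>_eq_iff[of a' a] by auto
    then show thesis using 2 that unfolding signed_basis_def
      by (metis UnCI imageI scale_minus_left scale_minus_right)
  qed
qed

lemma colour_eq_pair:
  assumes "colour x = 9/5 \<or> colour x = 8/5"
  obtains b c where "b \<in> B" "c \<in> B" "b \<noteq> c" "x = b + c \<or> x = - (b + c)"
proof -
  have "colour x \<noteq> \<nu> a" for a using assms \<nu>_le[of a] by auto
  moreover have "colour x \<noteq> 0" "colour x \<noteq> 1" "colour x \<noteq> 2" using assms by auto
  ultimately have "\<exists>b\<in>B. \<exists>c\<in>B. b \<noteq> c \<and> (x = b + c \<or> x = - (b + c))"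
    using colour_cases[of x] by metis
  then show thesis using that by blast
qed

text \<open>All nonzero coordinates of the right side equal \<open>s\<close>, while the left side
  has both 1 and -1 among its coordinates. This is how the colours of sums detect signs.\<close>

lemma difference_eq_sumD:
  assumes "b \<in> B" "c \<in> B" "b \<noteq> c" "b' \<in> B" "c' \<in> B" "b' \<noteq> c'"
    and eq: "b + (-1) \<odot> c = s \<odot> (b' + c')"
  shows "(1::'k) = -1"
proof -
  have "coord b x + (-1) * coord c x = s * (coord b' x + coord c' x)" for x
    using coord_eqI[OF eq, of x] by (simp only: coord_add coord_scale)
  from this[of b] this[of c] show ?thesis using assms(1-6) by (auto split: if_splits)
qed

text \<open>Comparing supports puts all three vectors on one basis line; opposite signs of
  \<open>e\<close> and \<open>e'\<close> would then force 2 = 0 or 2a = 0. It serves to locate a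
  point seen from two points of a line.\<close>

lemma collinear_signed:
  assumes "e \<in> signed_basis" "e' \<in> signed_basis" "e'' \<in> signed_basis" "a \<noteq> 0" "a \<noteq> 1"
    and eq: "a \<odot> e = e' + (a - 1) \<odot> e''"
  shows "e = e'"
proof -
  from assms(1) obtain b s where b: "b \<in> B" "s = 1 \<or> s = -1" "e = s \<odot> b"
    by (rule signed_basisE)
  from assms(2) obtain b' s' where b': "b' \<in> B" "s' = 1 \<or> s' = -1" "e' = s' \<odot> b'"
    by (rule signed_basisE)
  from assms(3) obtain b'' s'' where b'': "b'' \<in> B" "s'' = 1 \<or> s'' = -1" "e'' = s'' \<odot> b''"
    by (rule signed_basisE)
  have nz: "s \<noteq> 0" "s' \<noteq> 0" "s'' \<noteq> 0" using b(2) b'(2) b''(2) by auto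
  have crd: "a * s * coord b x = s' * coord b' x + (a - 1) * s'' * coord b'' x" for x
    using coord_eqI[OF eq, of x] unfolding b(3) b'(3) b''(3) by simp
  have "b = b'"
    using crd[of b] crd[of b'] b(1) b'(1) b''(1) nz assms(4,5) by (auto split: if_splits)
  moreover from this have "b'' = b"
    using crd[of b''] b(1) b'(1) b''(1) nz assms(4,5) by (auto split: if_splits)
  ultimately have sgn: "a * s = s' + (a - 1) * s''" using crd[of b] b(1) by simp
  \<comment> \<open>In characteristic 2 the two signs coincide.\<close>
  have two: "(2::'k) \<noteq> 0" if "s \<noteq> s'"
  proof
    assume "(2::'k) = 0"
    then have "(1::'k) = -1" by (metis add_eq_0_iff2 one_add_one)
    then show False using that b(2) b'(2) by metis
  qed
  have "s = s'"
  proof (rule ccontr)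
    assume ne: "s \<noteq> s'"
    then have "(2::'k) \<noteq> 0" by (rule two)
    moreover have "s' = - s" using ne b(2) b'(2) by auto
    then have "(a + 1) * s = (a - 1) * s''" using sgn by (simp add: algebra_simps)
    then have "a + 1 = a - 1 \<or> a + 1 = - (a - 1)"
      using b(2) b''(2) by (elim disjE) (simp_all add: minus_equation_iff[of "a + 1"])
    then have "2 = (0::'k) \<or> 2 * a = 0" by (auto simp: algebra_simps)
    ultimately show False using assms(4) by simp
  qed
  then show ?thesis using \<open>b = b'\<close> b(3) b'(3) by simp
qed

text \<open>With \<open>e\<close> and \<open>g\<close> in different directions, the
  \<open>c\<close>-coordinate can only be matched by \<open>g'\<close>, unless the right side
  cancels to 0. So opposite sides of the parallelogram agree.\<close>

lemma parallelogram_signed: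
  assumes "e \<in> signed_basis" "e' \<in> signed_basis" "g \<in> signed_basis" "g' \<in> signed_basis"
    and "a \<noteq> 0" "e \<noteq> g" "e \<noteq> - g" and nz: "g + a \<odot> e' \<noteq> 0"
    and eq: "a \<odot> e + g' = g + a \<odot> e'"
  shows "g' = g"
proof -
  from assms(1) obtain b s where b: "b \<in> B" "s = 1 \<or> s = -1" "e = s \<odot> b"
    by (rule signed_basisE)
  from assms(2) obtain b' s' where b': "b' \<in> B" "s' = 1 \<or> s' = -1" "e' = s' \<odot> b'"
    by (rule signed_basisE)
  from assms(3) obtain c t where c: "c \<in> B" "t = 1 \<or> t = -1" "g = t \<odot> c"
    by (rule signed_basisE)
  from assms(4) obtain c' t' where c': "c' \<in> B" "t' = 1 \<or> t' = -1" "g' = t' \<odot> c'"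
    by (rule signed_basisE)
  have s: "s \<noteq> 0" and t: "t \<noteq> 0" using b(2) c(2) by auto
  have "b \<noteq> c" using assms(6,7) b(2,3) c(2,3) by auto
  have crd: "a * s * coord b x + t' * coord c' x = t * coord c x + a * s' * coord b' x" for x
    using coord_eqI[OF eq, of x] unfolding b(3) b'(3) c(3) c'(3) by simp
  have "c' = c"
  proof (rule ccontr)
    assume "c' \<noteq> c"
    with crd[of c] \<open>b \<noteq> c\<close> t b(1) b'(1) c(1) c'(1) have "b' = c" by (auto split: if_splits)
    with crd[of c] \<open>b \<noteq> c\<close> \<open>c' \<noteq> c\<close> b(1) c(1) c'(1) have "t + a * s' = 0"
      by (auto split: if_splits)
    then have "(t + a * s') \<odot> c = 0" by simp
    then show False using nz c(3) b'(3) \<open>b' = c\<close> by (simp add: scale_left_distrib)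
  qed
  moreover from this have "b' \<noteq> c"
    using crd[of b] \<open>b \<noteq> c\<close> s b(1) c(1) assms(5) by auto
  ultimately have "t' = t" using crd[of c] \<open>b \<noteq> c\<close> b(1) b'(1) c(1) by simp
  then show ?thesis using \<open>c' = c\<close> c(3) c'(3) by simp
qed

section \<open>Colour-preserving surjections fixing 0 are linear\<close>

context
  fixes f :: "'v \<Rightarrow> 'v"
  assumes f_0: "f 0 = 0" and f_colour: "\<And>x y. colour (f x - f y) = colour (x - y)"
    and f_surj: "surj f"
begin

lemma f_eq_iff: "f x = f y \<longleftrightarrow> x = y"
  using f_colour[of x y] colour_eq_0_iff by (metis right_minus_eq)

text \<open>The image of \<open>x + a \<odot> b\<close> differs from those of \<open>x\<close> and
  of \<open>x + b\<close> by multiples of signed basis vectors, and \<open>collinear_signed\<close>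
  aligns the two. At this stage \<open>e\<close> may still depend on \<open>x\<close>.\<close>

lemma f_line:
  assumes "b \<in> B"
  obtains e where "e \<in> signed_basis" "\<And>a. f (x + a \<odot> b) = f x + a \<odot> e"
proof -
  have step: "\<exists>e\<in>signed_basis. f (x + a \<odot> b) - f (x + a' \<odot> b) = (a - a') \<odot> e" if "a \<noteq> a'" for a a'
  proof -
    have "colour (f (x + a \<odot> b) - f (x + a' \<odot> b)) = colour ((a - a') \<odot> b)"
      by (simp add: f_colour scale_left_diff_distrib)
    with that assms show ?thesis using colour_eq_single by (metis right_minus_eq)
  qed
  obtain e where e: "e \<in> signed_basis" "f (x + 1 \<odot> b) - f (x + 0 \<odot> b) = e"
    using step[of 1 0] by auto
  have "f (x + a \<odot> b) = f x + a \<odot> e" for a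
  proof -
    consider "a = 0" | "a = 1" | "a \<noteq> 0" "a \<noteq> 1" by blast
    then show ?thesis
    proof cases
      case 3
      obtain e' e'' where "e' \<in> signed_basis" "f (x + a \<odot> b) - f x = a \<odot> e'"
        "e'' \<in> signed_basis" "f (x + a \<odot> b) - f (x + 1 \<odot> b) = (a - 1) \<odot> e''"
        using step[of a 0] step[of a 1] 3 by auto
      moreover from this e have "a \<odot> e' = e + (a - 1) \<odot> e''" by (auto simp: algebra_simps)
      ultimately show ?thesis using collinear_signed 3 e(1) by (metis add.commute diff_add_cancel)
    qed (use e in \<open>auto simp: algebra_simps\<close>)
  qed
  with e(1) show thesis by (rule that)
qed

text \<open>For \<open>b \<noteq> c\<close> the two routes from \<open>x\<close> to
  \<open>x + a \<odot> b + c\<close> map to two routes along signed basis directions. Injectivity of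
  \<open>f\<close> excludes the degenerate cases of \<open>parallelogram_signed\<close>.\<close>

lemma f_step:
  assumes "b \<in> B" "c \<in> B"
  shows "f (x + a \<odot> b + c) - f (x + a \<odot> b) = f (x + c) - f x"
proof (cases "b = c")
  case True
  obtain e where e: "\<And>a. f (x + a \<odot> b) = f x + a \<odot> e"
    using f_line[OF assms(1)] by metis
  have "f (x + (a + 1) \<odot> b) - f (x + a \<odot> b) = f (x + 1 \<odot> b) - f x"
    unfolding e by (simp add: scale_left_distrib)
  then show ?thesis using True by (simp add: scale_left_distrib add.assoc)
next
  case False
  show ?thesis
  proof (cases "a = 0")
    case a: False
    obtain e where e: "e \<in> signed_basis" "\<And>a. f (x + a \<odot> b) = f x + a \<odot> e"
      using f_line[OF assms(1)] by metis
    obtain g where g: "g \<in> signed_basis" "\<And>a. f (x + a \<odot> c) = f x + a \<odot> g"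
      using f_line[OF assms(2)] by metis
    obtain g' where g': "g' \<in> signed_basis" "\<And>a'. f (x + a \<odot> b + a' \<odot> c) = f (x + a \<odot> b) + a' \<odot> g'"
      using f_line[OF assms(2)] by metis
    obtain e' where e': "e' \<in> signed_basis" "\<And>a. f (x + 1 \<odot> c + a \<odot> b) = f (x + 1 \<odot> c) + a \<odot> e'"
      using f_line[OF assms(1)] by metis
    have g'1: "f (x + a \<odot> b + c) = f x + a \<odot> e + g'" using g'(2)[of 1] e by simp
    have e'1: "f (x + a \<odot> b + c) = f x + g + a \<odot> e'"
      using e'(2)[of a] g(2)[of 1] by (simp add: algebra_simps)
    have "e \<noteq> g"
      using e(2)[of 1] g(2)[of 1] f_eq_iff[of "x + b" "x + c"] False by auto
    moreover have "e \<noteq> - g"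
    proof
      assume "e = - g"
      then have "f (x + b) = f (x + (-1) \<odot> c)" using e(2)[of 1] g(2)[of "-1"] by simp
      then have "1 \<odot> b = (-1) \<odot> c" using f_eq_iff by (metis add_left_cancel scale_one)
      then show False using single_eqD[of 1 b "-1" c] assms False by simp
    qed
    moreover have "g + a \<odot> e' \<noteq> 0"
    proof
      assume "g + a \<odot> e' = 0"
      then have "f (x + a \<odot> b + c) = f x" using e'1 by (simp add: add.assoc)
      then have "a \<odot> b + c = 0" by (simp add: f_eq_iff add.assoc)
      then have "a \<odot> b = (-1) \<odot> c" by (simp add: eq_neg_iff_add_eq_0)
      then show False using single_eqD[of a b "-1" c] assms False a by simp
    qed
    moreover have "a \<odot> e + g' = g + a \<odot> e'" using g'1 e'1 by (simp add: add.assoc)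
    ultimately have "g' = g"
      using parallelogram_signed[of e e' g g' a] e(1) e'(1) g(1) g'(1) a by blast
    then show ?thesis using g'1 e(2)[of a] g(2)[of 1] by simp
  qed simp
qed

text \<open>Walking from 0 to \<open>x\<close> along basis directions, \<open>f_step\<close> keeps
  the increment along \<open>b\<close> constant.\<close>

lemma f_add_basis: "b \<in> B \<Longrightarrow> f (x + b) = f x + f b"
proof -
  assume b: "b \<in> B"
  have "x \<in> span B" using span by simp
  then have "f (x + b) - f x = f (0 + b) - f 0"
  proof (induction rule: span_induct_alt)
    case (step a c y)
    then show ?case using f_step[of c b y a] b by (simp add: add.commute)
  qed simp
  then show ?thesis using f_0 by (simp add: algebra_simps)
qed

lemma f_basis: "b \<in> B \<Longrightarrow> f b \<in> signed_basis"
  using f_line[of b 0] f_0 by (metis add_0 scale_one)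

lemma f_add_scale: "b \<in> B \<Longrightarrow> f (x + a \<odot> b) = f x + a \<odot> f b"
  using f_line[of b x] f_add_basis[of b x] by (metis add_left_cancel scale_one)

lemma f_add: "f (x + y) = f x + f y"
proof -
  have "y \<in> span B" using span by simp
  then show ?thesis
  proof (induction rule: span_induct_alt)
    case (step a b z)
    have "f (x + (a \<odot> b + z)) = f (x + z) + a \<odot> f b"
      using f_add_scale[of b "x + z" a] step by (simp add: algebra_simps)
    moreover have "f (a \<odot> b + z) = f z + a \<odot> f b"
      using f_add_scale[of b z a] step by (simp add: algebra_simps)
    ultimately show ?case using step by (simp add: algebra_simps)
  qed (simp add: f_0)
qed

lemma f_minus: "f (- x) = - f x"
  using f_add[of x "- x"] f_0 by (simp add: eq_neg_iff_add_eq_0 add.commute)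

lemma colour_f: "colour (f x) = colour x"
  using f_colour[of x 0] f_0 by simp

text \<open>The restriction to \<open>B\<close> is a permutation; colour 2 makes it respect
  \<open>P\<close>, and the colours 9/5 and 8/5 of sums make it respect \<open>E\<close>. Rigidity
  fixes \<open>B\<close>, and linearity the rest.\<close>

lemma f_eq_id:
  assumes f_B: "\<And>b. b \<in> B \<Longrightarrow> f b \<in> B"
  shows "f x = x"
proof -
  have "\<forall>b\<in>B. f b = b"
  proof (intro rigid_graph[unfolded rigid_graph_def, THEN conjunct2, rule_format, THEN ballI] conjI ballI impI)
    have "c \<in> f ` B" if c: "c \<in> B" for c
    proof -
      obtain x where x: "f x = c" using f_surj by (metis surjD)
      then have "colour x = colour (1 \<odot> c)" using colour_f[of x] by simp
      then have "x \<in> signed_basis" using colour_eq_single[of x 1 c] c by auto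
      then consider "x \<in> B" | "- x \<in> B" by (auto simp: signed_basis_def)
      then show ?thesis
      proof cases
        \<comment> \<open>Both \<open>c\<close> and \<open>- c\<close> are then basis vectors, which
          independence allows only if they are equal.\<close>
        case 2
        have "(-1) \<odot> c \<in> B" using f_B[OF 2] x f_minus by simp
        then have "- c = c" using single_eqD[of "-1" c 1 "- c"] c by auto
        then show ?thesis using 2 x f_minus by (metis imageI)
      qed (use x in auto)
    qed
    then show "bij_betw f B B"
      using f_B f_eq_iff by (auto simp: bij_betw_def inj_on_def)
    show "P (f c) = P c" if "c \<in> B" for c
      using colour_f[of c] colour_single[of 1 c] colour_single[of 1 "f c"] that f_B \<nu>_le[of 1]
      by (auto split: if_splits)
    show "E (f c) (f c') = E c c'" if "c \<in> B" "c' \<in> B" "c \<noteq> c'" for c c'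
    proof -
      have "colour (f c + f c') = colour (c + c')" using colour_f[of "c + c'"] f_add by simp
      then show ?thesis
        using colour_pair[of c c'] colour_pair[of "f c" "f c'"] that f_B f_eq_iff
        by (auto split: if_splits)
    qed
  qed
  then have fb: "f b = b" if "b \<in> B" for b using that by blast
  have "x \<in> span B" using span by simp
  then show ?thesis
  proof (induction rule: span_induct_alt)
    case (step a b z)
    then show ?case using f_add_scale[of b z a] fb[of b] by (simp add: add.commute)
  qed (rule f_0)
qed

text \<open>Mixed signs would turn \<open>b + c\<close> into a difference of basis vectors that
  carries the colour of a sum, forcing 1 = -1. But then \<open>- f b = f b\<close>, so the signs
  were not mixed.\<close>

lemma f_sign: "(\<forall>b\<in>B. f b \<in> B) \<or> (\<forall>b\<in>B. - f b \<in> B)"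
proof -
  have False if b: "b \<in> B" "f b \<notin> B" and c: "c \<in> B" "- f c \<notin> B" for b c
  proof -
    have fb: "- f b \<in> B" and fc: "f c \<in> B" 
      using f_basis[OF b(1)] f_basis[OF c(1)] b(2) c(2) by (auto simp: signed_basis_def)
    have bc: "b \<noteq> c" using b fc by blast
    have "f c \<noteq> - f b"
    proof
      assume "f c = - f b"
      then have "1 \<odot> c = (-1) \<odot> b" using f_minus[of b] f_eq_iff[of c "- b"] by simp
      then show False using single_eqD[of 1 c "-1" b] b c bc by simp
    qed
    moreover have "- f b \<noteq> f b" using b fb by auto
    ultimately have ne: "f c \<noteq> - f b" "- f b \<noteq> f b" .
    have "colour (f b + f c) = colour (b + c)" using colour_f[of "b + c"] f_add by simp
    then have "colour (f b + f c) = 9/5 \<or> colour (f b + f c) = 8/5"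
      using colour_pair[of b c] b c bc by auto
    then obtain b' c' where *: "b' \<in> B" "c' \<in> B" "b' \<noteq> c'"
      "f b + f c = b' + c' \<or> f b + f c = - (b' + c')"
      by (rule colour_eq_pair)
    then have "f c + (-1) \<odot> (- f b) = 1 \<odot> (b' + c') \<or> f c + (-1) \<odot> (- f b) = (-1) \<odot> (b' + c')"
      by (simp add: add.commute)
    then have "(1::'k) = -1"
      using difference_eq_sumD[OF fc fb ne(1) *(1-3)] by blast
    then have "- f b = f b" by (metis scale_minus_left scale_one)
    then show False using ne by simp
  qed
  then show ?thesis by blast
qed

end

theorem colour_isometry:
  assumes "surj f" "f 0 = 0" "\<And>x y. colour (f x - f y) = colour (x - y)"
  shows "f = (\<lambda>x. x) \<or> f = uminus"
  using f_sign[OF assms(2,3,1)]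
proof
  assume "\<forall>b\<in>B. f b \<in> B"
  then show ?thesis using f_eq_id[OF assms(2,3,1)] by blast
next
  assume B: "\<forall>b\<in>B. - f b \<in> B"
  \<comment> \<open>The first case is now applied to the negative of \<open>f\<close>.\<close>
  have f0: "- f 0 = 0" using assms(2) by simp
  have surj: "surj (\<lambda>x. - f x)" using assms(1) by (metis surj_def minus_minus)
  have iso: "colour (- f x - - f y) = colour (x - y)" for x y
    using assms(3)[of y x] colour_minus[of "x - y"] by simp
  have "- f b \<in> B" if "b \<in> B" for b using B that by blast
  then have "- f x = x" for x by (rule f_eq_id[of "\<lambda>x. - f x", OF f0 iso surj])
  then have "f x = - x" for x by (metis minus_minus)
  then have "f = uminus" by (rule ext)
  then show ?thesis by (rule disjI2)
qed

section \<open>The metric and its isometry group\<close>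

definition dist_colour :: "'v \<Rightarrow> 'v \<Rightarrow> real" where "dist_colour x y = colour (x - y)"

lemma metric_values_dist_colour: "metric_values dist_colour = range colour"
  unfolding metric_values_def dist_colour_def by (auto; metis diff_zero)

lemma Metric_space_dist_colour: "Metric_space UNIV dist_colour"
proof
  show "0 \<le> dist_colour x y" for x y
    using colour_ge_1[of "x - y"] colour_eq_0_iff[of "x - y"] by (fastforce simp: dist_colour_def)
  show "dist_colour x y = dist_colour y x" for x y
    using colour_minus[of "x - y"] by (simp add: dist_colour_def)
  show "dist_colour x y = 0 \<longleftrightarrow> x = y" for x y
    by (simp add: dist_colour_def colour_eq_0_iff)
  show "dist_colour x z \<le> dist_colour x y + dist_colour y z" for x y z
  proof (cases "x = y \<or> y = z")
    case True
    then show ?thesis using colour_eq_0_iff[of 0] by (auto simp: dist_colour_def)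
  next
    \<comment> \<open>The right side is at least 1 + 1, the left side at most 2.\<close>
    case False
    then show ?thesis
      using colour_ge_1[of "x - y"] colour_ge_1[of "y - z"] colour_le_2[of "x - z"]
      by (simp add: dist_colour_def)
  qed
qed

lemma Isom_dist_colour: "Isom dist_colour = Aff_pm scale"
proof
  show "Isom dist_colour \<subseteq> Aff_pm scale"
  proof
    fix f assume "f \<in> Isom dist_colour"
    then have surj: "surj f" and iso: "\<And>x y. colour (f x - f y) = colour (x - y)"
      by (auto simp: Isom_def dist_colour_def)
    \<comment> \<open>A translation reduces to an isometry fixing 0.\<close>
    have "surj (\<lambda>x. f x - f 0)"
      using surj by (metis surj_def add_diff_cancel)
    then have "(\<lambda>x. f x - f 0) = (\<lambda>x. x) \<or> (\<lambda>x. f x - f 0) = uminus"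
      by (rule colour_isometry) (simp_all add: iso)
    then have "f = (\<lambda>x. f 0 + 1 \<odot> x) \<or> f = (\<lambda>x. f 0 + (-1) \<odot> x)"
      by (auto simp: fun_eq_iff algebra_simps)
    then show "f \<in> Aff_pm scale" unfolding Aff_pm_def by blast
  qed
next
  show "Aff_pm scale \<subseteq> Isom dist_colour"
  proof
    fix f assume "f \<in> Aff_pm scale"
    then obtain c s where f: "f = (\<lambda>x. c + s \<odot> x)" "s = 1 \<or> s = -1"
      by (auto simp: Aff_pm_def)
    have "f (s \<odot> (y - c)) = y" for y using f by auto
    then have "surj f" by (metis surj_def)
    moreover have "colour (f x - f y) = colour (x - y)" for x y
      using f colour_minus[of "x - y"] by auto
    ultimately show "f \<in> Isom dist_colour" by (simp add: Isom_def dist_colour_def)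
  qed
qed

end

section \<open>Completeness, choice of scalar colours, and the count of values\<close>

text \<open>Cauchy sequences are eventually constant.\<close>

lemma uniformly_discrete_imp_mcomplete:
  assumes "Metric_space UNIV d" "uniformly_discrete d"
  shows "Metric_space.mcomplete UNIV d"
proof -
  interpret Metric_space UNIV d by fact
  obtain \<epsilon> where \<epsilon>: "\<epsilon> > 0" "\<And>x y. d x y \<noteq> 0 \<Longrightarrow> \<epsilon> \<le> d x y"
    using assms(2) unfolding uniformly_discrete_def metric_values_def by blast
  show ?thesis
    unfolding mcomplete_def
  proof (intro allI impI)
    fix \<sigma> assume "MCauchy \<sigma>"
    then obtain N where N: "\<And>n n'. N \<le> n \<Longrightarrow> N \<le> n' \<Longrightarrow> d (\<sigma> n) (\<sigma> n') < \<epsilon>"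
      using \<epsilon>(1) unfolding MCauchy_def by blast
    have "\<sigma> n = \<sigma> N" if "N \<le> n" for n
      using N[OF that order_refl] \<epsilon>(2)[of "\<sigma> n" "\<sigma> N"] by fastforce
    then have "\<forall>\<^sub>F n in sequentially. \<sigma> n = \<sigma> N"
      unfolding eventually_sequentially by blast
    then have "limitin mtopology \<sigma> (\<sigma> N) sequentially"
      by (intro limitin_eventually) simp_all
    then show "\<exists>x. limitin mtopology \<sigma> x sequentially" by blast
  qed
qed

text \<open>Countability of the field supplies the scalar colours. The inclusion for the values
  leaves the counting over each field to the theorem.\<close>

lemma rigid_translation_invariant_metric:
  fixes smul :: "'k::field \<Rightarrow> 'v::ab_group_add \<Rightarrow> 'v"
  assumes "vector_space smul" and count: "countable (UNIV :: 'k set)"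
  obtains d and \<nu> :: "'k \<Rightarrow> real"
  where "Metric_space UNIV d" "metric_values d \<subseteq> {0..2}" "translation_invariant d"
    "Isom d = Aff_pm smul" "metric_values d \<subseteq> {0, 1, 2, 8/5, 9/5} \<union> \<nu> ` (UNIV - {0})"
    "Metric_space.mbounded UNIV d UNIV" "uniformly_discrete d" "Metric_space.mcomplete UNIV d"
proof -
  interpret vector_space smul by fact
  obtain B where B: "\<not> dependent B" "span B = UNIV"
    using maximal_independent_subset[of UNIV] by (metis UNIV_eq_I top.extremum_uniqueI)
  obtain P E where PE: "rigid_graph B P E"
    using rigid_graph_exists by blast
  define n :: "'k \<Rightarrow> nat" where "n = to_nat_on UNIV"
  have n_inj: "n a = n b \<longleftrightarrow> a = b" for a b
    using count by (simp add: n_def)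
  \<comment> \<open>A label of the pair of \<open>a\<close> and \<open>- a\<close>, namely its
    smaller index.\<close>
  define m where "m a = min (n a) (n (- a))" for a
  have m_iff: "m a = m b \<longleftrightarrow> a = b \<or> a = - b" for a b
    unfolding m_def using n_inj[of a b] n_inj[of a "- b"] n_inj[of "- a" b] n_inj[of "- a" "- b"]
    by (auto simp: min_def equation_minus_iff split: if_splits)
  \<comment> \<open>The summand 2 in the denominator keeps the values at most 3/2.\<close>
  define \<nu> where "\<nu> a = 1 + 1 / (2 + real (m a))" for a
  interpret rigid_colouring smul B P E \<nu>
  proof
    show "\<nu> a = \<nu> b \<longleftrightarrow> a = b \<or> a = - b" for a b
      unfolding m_iff[symmetric] by (auto simp: \<nu>_def field_simps)
  qed (use B PE in \<open>auto simp: \<nu>_def field_simps\<close>)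
  have values_bounded: "metric_values dist_colour \<subseteq> {0..2}"
    using colour_ge_1 colour_le_2 colour_eq_0_iff unfolding metric_values_dist_colour
    by (auto) (metis dual_order.trans order_refl zero_le_one)
  have ud: "uniformly_discrete dist_colour"
    unfolding uniformly_discrete_def metric_values_dist_colour
    using colour_ge_1 colour_eq_0_iff by (auto intro!: exI[of _ 1])
  have bounded: "Metric_space.mbounded UNIV dist_colour UNIV"
    unfolding Metric_space.mbounded_def[OF Metric_space_dist_colour]
      Metric_space.mcball_def[OF Metric_space_dist_colour]
    using colour_le_2 by (auto simp: dist_colour_def)
  show thesis
  proof (rule that[of dist_colour \<nu>])
    show "translation_invariant dist_colour"
      by (simp add: translation_invariant_def dist_colour_def)
  qed (use Metric_space_dist_colour values_bounded Isom_dist_colour range_colour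
        metric_values_dist_colour bounded ud
        uniformly_discrete_imp_mcomplete[OF Metric_space_dist_colour ud] in simp_all)
qed

lemma Aff_pm_eq_Transl:
  fixes smul :: "'k::field \<Rightarrow> 'v::ab_group_add \<Rightarrow> 'v"
  assumes "vector_space smul" "(2::'k) = 0"
  shows "Aff_pm smul = Transl"
proof -
  interpret vector_space smul by fact
  have "(- 1 :: 'k) = 1" using assms(2) by (metis add_eq_0_iff2 one_add_one)
  then have "{1, - 1 :: 'k} = {1}" by (metis insert_absorb2)
  then show ?thesis by (simp only: Aff_pm_def Transl_def) simp
qed

theorem theoremB1:
  shows "(\<forall>smul :: rat \<Rightarrow> 'v::ab_group_add \<Rightarrow> 'v. vector_space smul \<longrightarrow>
            (\<exists>d. Metric_space UNIV d \<and> metric_values d \<subseteq> {0..2} \<and> translation_invariant d \<and>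
                 Isom d = Aff_pm smul \<and>
                 countable (metric_values d) \<and>
                 Metric_space.mbounded UNIV d UNIV \<and>
                 uniformly_discrete d \<and>
                 Metric_space.mcomplete UNIV d))
       \<and> (\<forall>smul :: 'p::prime_card mod_ring \<Rightarrow> 'w::ab_group_add \<Rightarrow> 'w. vector_space smul \<longrightarrow>
            (\<exists>d. Metric_space UNIV d \<and> metric_values d \<subseteq> {0..2} \<and> translation_invariant d \<and>
                 Isom d = Aff_pm smul \<and>
                 (odd CARD('p) \<longrightarrow>
                    finite (metric_values d) \<and> card (metric_values d) \<le> CARD('p) + 5) \<and>
                 (CARD('p) = 2 \<longrightarrow>
                    finite (metric_values d) \<and> card (metric_values d) \<le> 6 \<and>
                    Aff_pm smul = Transl) \<and>
                 Metric_space.mbounded UNIV d UNIV \<and>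
                 uniformly_discrete d \<and>
                 Metric_space.mcomplete UNIV d))"
proof (intro conjI allI impI)
  fix smul :: "rat \<Rightarrow> 'v \<Rightarrow> 'v"
  assume "vector_space smul"
  then obtain d and \<nu> :: "rat \<Rightarrow> real" where d: "Metric_space UNIV d" "metric_values d \<subseteq> {0..2}"
    "translation_invariant d" "Isom d = Aff_pm smul"
    "metric_values d \<subseteq> {0, 1, 2, 8/5, 9/5} \<union> \<nu> ` (UNIV - {0})"
    "Metric_space.mbounded UNIV d UNIV" "uniformly_discrete d" "Metric_space.mcomplete UNIV d"
    by (rule rigid_translation_invariant_metric) simp
  moreover have "countable (metric_values d)"
    using d(5) by (rule countable_subset) simp
  ultimately show "\<exists>d. Metric_space UNIV d \<and> metric_values d \<subseteq> {0..2} \<and> translation_invariant d \<and>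
                 Isom d = Aff_pm smul \<and>
                 countable (metric_values d) \<and>
                 Metric_space.mbounded UNIV d UNIV \<and>
                 uniformly_discrete d \<and>
                 Metric_space.mcomplete UNIV d"
    by blast
next
  fix smul :: "'p mod_ring \<Rightarrow> 'w \<Rightarrow> 'w"
  assume vs: "vector_space smul"
  then obtain d and \<nu> :: "'p mod_ring \<Rightarrow> real" where d: "Metric_space UNIV d" "metric_values d \<subseteq> {0..2}"
    "translation_invariant d" "Isom d = Aff_pm smul"
    "metric_values d \<subseteq> {0, 1, 2, 8/5, 9/5} \<union> \<nu> ` (UNIV - {0})"
    "Metric_space.mbounded UNIV d UNIV" "uniformly_discrete d" "Metric_space.mcomplete UNIV d"
    by (rule rigid_translation_invariant_metric) (simp add: countable_finite)
  have fin: "finite (metric_values d)"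
    using d(5) by (rule finite_subset) simp
  have "card (metric_values d) \<le> card ({0, 1, 2, 8/5, 9/5} \<union> \<nu> ` (UNIV - {0}))"
    using d(5) by (rule card_mono[rotated]) simp
  also have "\<dots> \<le> card {0, 1, 2, 8/5, 9/5 :: real} + card (\<nu> ` (UNIV - {0}))"
    by (rule card_Un_le)
  also have "\<dots> \<le> 5 + card (UNIV - {0 :: 'p mod_ring})"
    by (intro add_mono card_image_le) (simp_all add: card_insert_if)
  also have "\<dots> = 5 + (CARD('p) - 1)" by (simp add: card_Diff_singleton)
  \<comment> \<open>This is p + 4, which is below p + 5 and equals six for p = 2.\<close>
  finally have card: "card (metric_values d) \<le> 5 + (CARD('p) - 1)" .
  have two: "Aff_pm smul = Transl" if "CARD('p) = 2"
  proof (rule Aff_pm_eq_Transl[OF vs])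
    have "of_nat CARD('p) = (0 :: 'p mod_ring)" by (rule of_nat_card_eq_0)
    then show "(2 :: 'p mod_ring) = 0" using that by simp
  qed
  show "\<exists>d. Metric_space UNIV d \<and> metric_values d \<subseteq> {0..2} \<and> translation_invariant d \<and>
                 Isom d = Aff_pm smul \<and>
                 (odd CARD('p) \<longrightarrow>
                    finite (metric_values d) \<and> card (metric_values d) \<le> CARD('p) + 5) \<and>
                 (CARD('p) = 2 \<longrightarrow>
                    finite (metric_values d) \<and> card (metric_values d) \<le> 6 \<and>
                    Aff_pm smul = Transl) \<and>
                 Metric_space.mbounded UNIV d UNIV \<and>
                 uniformly_discrete d \<and>
                 Metric_space.mcomplete UNIV d"
    using d fin card two by (intro exI[of _ d]) auto
qed

end
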